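(* Let $\phi$ be a Ma-Minda function, let $K$ be defined by $1+\frac{zK''(z)}{K'(z)}=\phi(z)$, $K(0)=K'(0)-1=0$, and let $\alpha\in\mathbb{C}$ with $|\alpha|\le1$. Let $f\in\mathcal{HC}(\phi)$, let $0<r<1$, $\mathbb{D}_r=\{z:|z|<r\}$, and let $S_r$ be the area of the image $f(\mathbb{D}_r)$. Then $$2\pi\int_0^r t(1-|\alpha|^2t^2)(K'(-t))^2\,dt\le S_r\le 2\pi\int_0^r t(1-|\alpha|^2t^2)(K'(t))^2\,dt.$$
   Context: $\mathbb{D}=\{z\in\mathbb{C}:|z|<1\}$. A Ma-Minda function is an analytic univalent $\phi:\mathbb{D}\to\mathbb{C}$ such that $\phi(\mathbb{D})$ has positive real part, is symmetric with respect to the real axis, is starlike with respect to $\phi(0)=1$, and $\phi'(0)>0$. $F\prec G$ means $F=G\circ\omega$ for some analytic $\omega:\mathbb{D}\to\mathbb{D}$ with $\omega(0)=0$. $\mathcal{C}(\phi)$ is the class of univalent analytic $f$ on $\mathbb{D}$ with $f(0)=0,f'(0)=1$ and $1+zf''(z)/f'(z)\prec\phi(z)$. For $\alpha\in\mathbb{C}$ with $|\alpha|\le1$, $\mathcal{HC}(\phi)$ is the class of harmonic mappings $f=h+\overline{g}$ on $\mathbb{D}$ with $h(z)=z+\sum_{n\ge2}a_nz^n$, $g(z)=\sum_{n\ge2}b_nz^n$, $h\in\mathcal{C}(\phi)$ and $g'(z)=\alpha zh'(z)$. *)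

theory Defs
  imports "HOL-Analysis.Analysis"
begin

abbreviation unit_disc :: "complex set" where
  "unit_disc \<equiv> ball 0 1"

definition ma_minda :: "(complex \<Rightarrow> complex) \<Rightarrow> bool" where
  "ma_minda \<phi> \<longleftrightarrow>
     \<phi> holomorphic_on unit_disc \<and> inj_on \<phi> unit_disc \<and>
     (\<forall>z\<in>unit_disc. Re (\<phi> z) > 0) \<and>
     (\<forall>w\<in>\<phi> ` unit_disc. cnj w \<in> \<phi> ` unit_disc) \<and>
     \<phi> 0 = 1 \<and>
     (\<forall>w\<in>\<phi> ` unit_disc. closed_segment 1 w \<subseteq> \<phi> ` unit_disc) \<and>
     deriv \<phi> 0 \<in> \<real> \<and> Re (deriv \<phi> 0) > 0"

definition subordinate :: "(complex \<Rightarrow> complex) \<Rightarrow> (complex \<Rightarrow> complex) \<Rightarrow> bool" where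
  "subordinate F G \<longleftrightarrow>
     (\<exists>\<omega>. \<omega> holomorphic_on unit_disc \<and> \<omega> ` unit_disc \<subseteq> unit_disc \<and> \<omega> 0 = 0 \<and>
          (\<forall>z\<in>unit_disc. F z = G (\<omega> z)))"

definition convex_class :: "(complex \<Rightarrow> complex) \<Rightarrow> (complex \<Rightarrow> complex) \<Rightarrow> bool" where
  "convex_class \<phi> f \<longleftrightarrow>
     f holomorphic_on unit_disc \<and> inj_on f unit_disc \<and> f 0 = 0 \<and> deriv f 0 = 1 \<and>
     subordinate (\<lambda>z. 1 + z * deriv (deriv f) z / deriv f z) \<phi>"

definition harmonic_convex_class ::
  "(complex \<Rightarrow> complex) \<Rightarrow> complex \<Rightarrow> (complex \<Rightarrow> complex) \<Rightarrow> bool" where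
  "harmonic_convex_class \<phi> \<alpha> f \<longleftrightarrow>
     (\<exists>h g. convex_class \<phi> h \<and> g holomorphic_on unit_disc \<and> g 0 = 0 \<and> deriv g 0 = 0 \<and>
        (\<forall>z\<in>unit_disc. deriv g z = \<alpha> * z * deriv h z) \<and>
        (\<forall>z\<in>unit_disc. f z = h z + cnj (g z)))"

end

theory Submission
  imports Defs "HOL-Complex_Analysis.Complex_Analysis"
begin

text \<open>
  \<^item> Growth: if \<open>p = log h'\<close> and \<open>q = log K'\<close>, then \<open>z p' = \<phi> \<circ> \<omega> - 1\<close> and \<open>z q' = \<phi> - 1\<close>. Where
    \<open>Re p\<close> is maximal on a circle, \<open>z p'\<close> is real; since \<open>\<phi>\<close> is real only on the real diameter and
    increasing there, \<open>\<omega> z\<close> is then real and \<open>z p' \<le> \<phi> |z| - 1\<close>. So the circular maximum of \<open>Re p\<close>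
    grows no faster than \<open>q\<close>, which gives \<open>K' (-|z|) \<le> |h' z| \<le> K' |z|\<close>.
  \<^item> Univalence: \<open>h\<close> maps discs onto convex sets, and \<open>g \<circ> h\<^sup>-\<^sup>1\<close> is a contraction there because
    \<open>|g'| \<le> |z| |h'|\<close>; hence \<open>h + cnj \<circ> g\<close> is injective.
  \<^item> Area: the change of variables formula in polar coordinates, with Jacobian
    \<open>t (|h'|\<^sup>2 - |g'|\<^sup>2) = t (1 - |\<alpha>|\<^sup>2 t\<^sup>2) |h'|\<^sup>2\<close>.
\<close>

section \<open>Growth of the derivative\<close>

text \<open>By the Schwarz lemma \<open>f\<^sup>-\<^sup>1 (cnj (f (cnj z)))\<close> is a rotation, with derivative 1 at 0.\<close>

lemma univalent_cnj_symmetric: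
  assumes holf: "f holomorphic_on ball 0 1" and injf: "inj_on f (ball 0 1)"
    and sym: "\<And>w. w \<in> f ` ball 0 1 \<Longrightarrow> cnj w \<in> f ` ball 0 1"
    and f0: "f 0 \<in> \<real>" and df0: "deriv f 0 \<in> \<real>"
    and z: "z \<in> ball 0 1"
  shows "f (cnj z) = cnj (f z)"
proof -
  obtain k where holk: "k holomorphic_on f ` ball 0 1"
    and dk: "\<And>z. z \<in> ball 0 1 \<Longrightarrow> deriv f z * deriv k (f z) = 1"
    and kf: "\<And>z. z \<in> ball 0 1 \<Longrightarrow> k (f z) = z"
    using holomorphic_has_inverse[OF holf _ injf] by auto
  define \<psi> where "\<psi> = (\<lambda>z. k (cnj (f (cnj z))))"
  have holc: "(\<lambda>z. cnj (f (cnj z))) holomorphic_on ball 0 1"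
  proof -
    have "cnj ` ball 0 1 = ball 0 1"
      by (auto simp: image_iff intro!: bexI[where x = "cnj x" for x])
    then show ?thesis
      using holomorphic_on_compose_cnj_cnj[of f "ball 0 1"] holf by (simp add: o_def)
  qed
  have img: "cnj (f (cnj z)) \<in> f ` ball 0 1" if "z \<in> ball 0 1" for z
    using that by (intro sym imageI) auto
  have hol\<psi>: "\<psi> holomorphic_on ball 0 1"
    using holomorphic_on_compose_gen[OF holc holk] img unfolding \<psi>_def o_def by blast
  have \<psi>0: "\<psi> 0 = 0"
  proof -
    have "cnj (f 0) = f 0" using f0 by (simp only: Reals_cnj_iff)
    then show ?thesis using kf[of 0] by (simp add: \<psi>_def)
  qed
  have bd: "norm (\<psi> z) < 1" if "norm z < 1" for z
  proof -
    have "z \<in> ball 0 1" using that by simp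
    from img[OF this] obtain w where w: "w \<in> ball 0 1" and eq: "cnj (f (cnj z)) = f w"
      by (elim imageE)
    have "\<psi> z = w" unfolding \<psi>_def eq by (rule kf[OF w])
    then show ?thesis using w by simp
  qed
  have opn: "open (f ` ball 0 1)"
    by (rule open_mapping_thm3[OF holf _ injf]) auto
  have "((\<lambda>z. cnj (f (cnj z))) has_field_derivative cnj (deriv f 0)) (at 0)"
    using has_field_derivative_cnj_cnj[of f "deriv f 0" 0] holomorphic_derivI[OF holf, of 0] by (simp add: o_def)
  moreover have "(k has_field_derivative deriv k (f 0)) (at (cnj (f (cnj 0))))"
    using holomorphic_derivI[OF holk opn, of "f 0"] f0 by (simp add: Reals_cnj_iff)
  ultimately have "(\<psi> has_field_derivative deriv k (f 0) * cnj (deriv f 0)) (at 0)"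
    unfolding \<psi>_def by (rule DERIV_chain2[rotated])
  moreover have "deriv k (f 0) * cnj (deriv f 0) = 1"
    using dk[of 0] df0 by (simp add: Reals_cnj_iff mult.commute)
  ultimately have d\<psi>: "(\<psi> has_field_derivative 1) (at 0)" by simp
  obtain a where a: "\<And>z. norm z < 1 \<Longrightarrow> \<psi> z = a * z"
    using Schwarz_Lemma(3)[OF hol\<psi> \<psi>0 bd, of 0] DERIV_imp_deriv[OF d\<psi>] by auto
  have "((\<lambda>z. a * z) has_field_derivative 1) (at 0)"
    by (rule has_field_derivative_transform_within_open[OF d\<psi>, of "ball 0 1"]) (auto simp: a)
  moreover have "((\<lambda>z. a * z) has_field_derivative a) (at 0)"
    by (auto intro!: derivative_eq_intros)
  ultimately have "a = 1" using DERIV_unique by blast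
  then have "k (cnj (f (cnj z))) = z" using a[of z] z by (simp add: \<psi>_def)
  \<comment> \<open>Only \<open>k\<close> after \<open>f\<close> is known to be the identity;
    writing the point as \<open>f w\<close> makes this applicable and yields
    \<open>w = z\<close>.\<close>
  moreover obtain w where "w \<in> ball 0 1" "cnj (f (cnj z)) = f w" using img[OF z] by (elim imageE)
  ultimately have "cnj (f (cnj z)) = f z" using kf by simp
  then show ?thesis by (metis complex_cnj_cnj)
qed

text \<open>By the conjugation symmetry, \<open>f z\<close> is real exactly when
  \<open>f (cnj z) = f z\<close>, and injectivity turns this into \<open>cnj z = z\<close>.\<close>

lemma univalent_real_iff:
  assumes "f holomorphic_on ball 0 1" "inj_on f (ball 0 1)"
    and "\<And>w. w \<in> f ` ball 0 1 \<Longrightarrow> cnj w \<in> f ` ball 0 1"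
    and "f 0 \<in> \<real>" "deriv f 0 \<in> \<real>" "z \<in> ball 0 1"
  shows "f z \<in> \<real> \<longleftrightarrow> z \<in> \<real>"
proof -
  have "f (cnj z) = cnj (f z)" by (rule univalent_cnj_symmetric[OF assms])
  moreover have "cnj z \<in> ball 0 1" using assms by auto
  ultimately show ?thesis
    using assms(2,6) by (metis Reals_cnj_iff inj_onD)
qed

text \<open>On the real diameter \<open>f\<close> is real, so its real part inherits injectivity. A
  continuous injective function on an interval is strictly monotone, and the positive derivative at
  0 excludes the decreasing case.\<close>

lemma univalent_real_strict_mono:
  assumes holf: "f holomorphic_on ball 0 1" and injf: "inj_on f (ball 0 1)"
    and sym: "\<And>w. w \<in> f ` ball 0 1 \<Longrightarrow> cnj w \<in> f ` ball 0 1"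
    and f0: "f 0 \<in> \<real>" and df0: "deriv f 0 \<in> \<real>" "Re (deriv f 0) > 0"
  shows "strict_mono_on {-1<..<1} (\<lambda>x. Re (f (of_real x)))"
proof -
  let ?g = "\<lambda>x. Re (f (of_real x))"
  have cont: "continuous_on {-1<..<1} ?g"
    by (intro continuous_intros continuous_on_compose2[OF holomorphic_on_imp_continuous_on[OF holf]]) auto
  have inj: "inj_on ?g {-1<..<1}"
  proof (rule inj_onI)
    fix x y :: real assume xy: "x \<in> {-1<..<1}" "y \<in> {-1<..<1}" "?g x = ?g y"
    then have in_ball: "of_real x \<in> ball (0::complex) 1" "of_real y \<in> ball (0::complex) 1" by auto
    have "f (of_real x) \<in> \<real>" "f (of_real y) \<in> \<real>"
      using univalent_real_iff[OF holf injf sym f0 df0(1)] in_ball by auto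
    then have "f (of_real x) = f (of_real y)"
      using xy by (metis of_real_Re)
    then show "x = y" using injf in_ball by (metis inj_onD of_real_eq_iff)
  qed
  have "(f has_field_derivative deriv f 0) (at (of_real 0))"
    using holomorphic_derivI[OF holf, of 0] by simp
  then have "((\<lambda>x. f (of_real x)) has_vector_derivative deriv f 0) (at 0)"
    by (rule has_vector_derivative_real_field)
  then have "(?g has_real_derivative Re (deriv f 0)) (at 0)"
    by (auto simp: has_vector_derivative_complex_iff)
  from DERIV_pos_inc_right[OF this df0(2)]
  obtain d where d: "d > 0" "\<And>h. 0 < h \<Longrightarrow> h < d \<Longrightarrow> ?g 0 < ?g (0 + h)" by auto
  define h where "h = min d 1 / 2"
  have h: "0 < h" "h < d" "h < 1" using d by (auto simp: h_def)
  then have "?g 0 < ?g h" using d(2)[of h] by simp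
  then have "\<not> strict_antimono_on {-1<..<1} ?g"
    using h unfolding monotone_on_def
    by (intro notI) (drule bspec[of _ _ 0]; auto dest: bspec[of _ _ h])
  then show ?thesis
    using injective_eq_monotone_map[OF _ cont] inj by (auto simp: is_interval_convex_1)
qed

section \<open>Comparison principle and two-sided growth bounds\<close>

text \<open>
  At a positive maximum of \<open>Re p - u |z| - e |z|\<close> the angular derivative vanishes, so \<open>z p'\<close> is real
  and \<open>le\<close> makes the radial derivative negative there, a contradiction.
\<close>

lemma Re_le_radial_majorant:
  fixes p :: "complex \<Rightarrow> complex" and u c :: "real \<Rightarrow> real"
  assumes holp: "p holomorphic_on ball 0 1" and p0: "Re (p 0) = u 0"
    and contu: "continuous_on {0..<1} u"
    and du: "\<And>t. 0 < t \<Longrightarrow> t < 1 \<Longrightarrow> (u has_real_derivative c t / t) (at t)"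
    and le: "\<And>z. z \<in> ball 0 1 \<Longrightarrow> z \<noteq> 0 \<Longrightarrow> z * deriv p z \<in> \<real> \<Longrightarrow> Re (z * deriv p z) \<le> c (norm z)"
    and w: "w \<in> ball 0 1"
  shows "Re (p w) \<le> u (norm w)"
proof (cases "w = 0")
  case False
  \<comment> \<open>The additional slope \<open>e\<close> turns the weak inequality
    \<open>le\<close> into a strictly negative radial derivative; at the end \<open>e\<close> tends
    to 0.\<close>
  have "Re (p w) \<le> u (norm w) + e * norm w" if e: "e > 0" for e
  proof (rule ccontr)
    assume neg: "\<not> ?thesis"
    define G where "G = (\<lambda>z. Re (p z) - u (norm z) - e * norm z)"
    have sub: "cball 0 (norm w) \<subseteq> ball (0::complex) 1" using w by auto
    have "continuous_on (cball 0 (norm w)) G"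
      unfolding G_def using w
      by (intro continuous_intros continuous_on_compose2[OF contu]
          continuous_on_subset[OF holomorphic_on_imp_continuous_on[OF holp] sub]) auto
    then obtain z where z: "norm z \<le> norm w" and max: "\<And>y. norm y \<le> norm w \<Longrightarrow> G y \<le> G z"
      using continuous_attains_sup[of "cball 0 (norm w)" G] by auto
    \<comment> \<open>\<open>G 0 = 0\<close> by \<open>p0\<close> and \<open>G w > 0\<close> by
      \<open>neg\<close>, so the maximum is not at the centre, where neither \<open>du\<close> nor
      \<open>le\<close> applies.\<close>
    have "G 0 < G z" using max[of w] neg p0 by (auto simp: G_def)
    then have z0: "z \<noteq> 0" by auto
    have z1: "z \<in> ball 0 1" using z w by auto
    have dp: "(p has_field_derivative deriv p z) (at z)"
      using holomorphic_derivI[OF holp _ z1] by simp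
    \<comment> \<open>Rotating \<open>z\<close> leaves the radial terms of \<open>G\<close> fixed,
      so \<open>Re p\<close> itself is maximal along the circle. Its angular derivative is
      \<open>- Im (z * deriv p z)\<close>.\<close>
    have rot: "((\<lambda>t. p (z * exp (\<i> * of_real t))) has_vector_derivative deriv p z * (z * \<i>)) (at 0)"
    proof (rule has_vector_derivative_real_field)
      show "((\<lambda>t. p (z * exp (\<i> * t))) has_field_derivative deriv p z * (z * \<i>)) (at (of_real 0))"
        by (rule DERIV_chain2[where f = p]) (use dp in \<open>auto intro!: derivative_eq_intros\<close>)
    qed
    then have "((\<lambda>t. Re (p (z * exp (\<i> * of_real t)))) has_real_derivative Re (deriv p z * (z * \<i>))) (at 0)"
      by (auto simp: has_vector_derivative_complex_iff)
    then have "Re (deriv p z * (z * \<i>)) = 0"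
    proof (rule DERIV_local_max[where d = 1])
      show "\<forall>y. \<bar>0 - y\<bar> < 1 \<longrightarrow> Re (p (z * exp (\<i> * of_real y))) \<le> Re (p (z * exp (\<i> * of_real 0)))"
      proof (intro allI impI)
        fix y :: real
        have "norm (z * exp (\<i> * of_real y)) = norm z" by (simp add: norm_mult)
        then show "Re (p (z * exp (\<i> * of_real y))) \<le> Re (p (z * exp (\<i> * of_real 0)))"
          using max[of "z * exp (\<i> * of_real y)"] z by (simp add: G_def)
      qed
    qed simp
    then have "z * deriv p z \<in> \<real>"
      by (simp add: complex_is_Real_iff algebra_simps)
    then have slope: "Re (z * deriv p z) \<le> c (norm z)" by (rule le[OF z1 z0])
    have rad: "((\<lambda>t. p (of_real t * z)) has_vector_derivative deriv p z * z) (at 1)"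
    proof (rule has_vector_derivative_real_field)
      show "((\<lambda>t. p (t * z)) has_field_derivative deriv p z * z) (at (of_real 1))"
        by (rule DERIV_chain2[where f = p]) (use dp in \<open>auto intro!: derivative_eq_intros\<close>)
    qed
    have "((\<lambda>t. u (t * norm z)) has_real_derivative c (norm z) / norm z * norm z) (at 1)"
      by (rule DERIV_chain2[where f = u]) (use du[of "norm z"] z0 z1 in \<open>auto intro!: derivative_eq_intros\<close>)
    moreover have "((\<lambda>t. Re (p (of_real t * z))) has_real_derivative Re (deriv p z * z)) (at 1)"
      using rad by (simp only: has_vector_derivative_complex_iff)
    moreover have "((\<lambda>t. e * (t * norm z)) has_real_derivative e * (1 * norm z)) (at 1)"
      by (auto intro!: derivative_eq_intros)
    ultimately have "((\<lambda>t. Re (p (of_real t * z)) - u (t * norm z) - e * (t * norm z)) has_real_derivative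
        Re (deriv p z * z) - c (norm z) / norm z * norm z - e * (1 * norm z)) (at 1)"
      by (intro DERIV_diff)
    moreover have "Re (deriv p z * z) - c (norm z) / norm z * norm z - e * (1 * norm z) < 0"
    proof -
      have "e * norm z > 0" using e z0 by simp
      then show ?thesis using slope z0 by (simp add: mult.commute)
    qed
    \<comment> \<open>A negative radial derivative means that moving inward from \<open>z\<close>
      increases \<open>G\<close>. Inward points stay in the closed disc, so this contradicts
      maximality even if \<open>z\<close> lies on its boundary.\<close>
    ultimately obtain d where d: "d > 0" "\<And>h. 0 < h \<Longrightarrow> h < d \<Longrightarrow>
        Re (p (of_real 1 * z)) - u (1 * norm z) - e * (1 * norm z)
        < Re (p (of_real (1 - h) * z)) - u ((1 - h) * norm z) - e * ((1 - h) * norm z)"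
      by (metis (no_types, lifting) DERIV_neg_dec_left)
    define h where "h = min d 1 / 2"
    have h: "0 < h" "h < d" "h < 1" using d by (auto simp: h_def)
    have nh: "norm (of_real (1 - h) * z) = (1 - h) * norm z"
      using h by (simp only: norm_mult norm_of_real)
    moreover have "(1 - h) * norm z \<le> norm z"
      using h by (intro mult_left_le_one_le) auto
    ultimately have "G (of_real (1 - h) * z) \<le> G z"
      using z by (intro max) linarith
    then show False using d(2)[OF h(1,2)] nh by (simp add: G_def)
  qed
  from this[of "e / norm w" for e] have "Re (p w) \<le> u (norm w) + e" if "e > 0" for e
    using that False by simp
  then show ?thesis by (rule field_le_epsilon)
qed (use p0 in simp)

text \<open>Turns the quotient \<open>deriv f z / f z\<close> into a derivative and the modulus of
  \<open>f\<close> into the exponential of a real part. Subtracting the value at 0 fixes the branch;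
  this is harmless because \<open>exp (g 0) = 1\<close>.\<close>

lemma obtain_holomorphic_log:
  assumes "f holomorphic_on ball 0 1" "\<And>z. z \<in> ball 0 1 \<Longrightarrow> f z \<noteq> 0" "f 0 = 1"
  obtains l where "l holomorphic_on ball 0 1" "l 0 = 0" "\<And>z. z \<in> ball 0 1 \<Longrightarrow> f z = exp (l z)"
    "\<And>z. z \<in> ball 0 1 \<Longrightarrow> deriv l z = deriv f z / f z"
proof -
  obtain g where g: "g holomorphic_on ball 0 1" "\<And>z. z \<in> ball 0 1 \<Longrightarrow> f z = exp (g z)"
    using contractible_imp_holomorphic_log[OF assms(1) _ assms(2)] convex_imp_contractible[OF convex_ball] by metis
  define l where "l = (\<lambda>z. g z - g 0)"
  have l: "l holomorphic_on ball 0 1" "l 0 = 0"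
    unfolding l_def by (auto intro!: holomorphic_intros g)
  have e: "f z = exp (l z)" if "z \<in> ball 0 1" for z
    using g(2)[OF that] g(2)[of 0] assms(3) by (simp add: l_def exp_diff)
  have "deriv l z = deriv f z / f z" if z: "z \<in> ball 0 1" for z
  proof -
    have "((\<lambda>z. exp (l z)) has_field_derivative exp (l z) * deriv l z) (at z)"
      using holomorphic_derivI[OF l(1) _ z] by (auto intro!: derivative_eq_intros)
    then have "(f has_field_derivative exp (l z) * deriv l z) (at z)"
      by (rule has_field_derivative_transform_within_open[of _ _ _ "ball 0 1"]) (use z e in auto)
    then show ?thesis using DERIV_imp_deriv e[OF z] by force
  qed
  with l e show ?thesis using that by blast
qed

text \<open>Used with \<open>H = deriv h\<close> and \<open>k = deriv K\<close>. The upper bound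
  compares \<open>p\<close> with \<open>q\<close> on the positive radius, the lower bound compares
  \<open>- p\<close> with \<open>- q\<close> on the negative radius. In both cases the Schwarz lemma
  confines the real value \<open>\<omega> w\<close> to \<open>[- norm w, norm w]\<close>, where
  \<open>\<phi>\<close> is increasing.\<close>

lemma ma_minda_growth:
  assumes mm: "ma_minda \<phi>"
    and holH: "H holomorphic_on ball 0 1" and H0: "H 0 = 1"
    and Hnz: "\<And>z. z \<in> ball 0 1 \<Longrightarrow> H z \<noteq> 0"
    and sub: "subordinate (\<lambda>z. 1 + z * deriv H z / H z) \<phi>"
    and holk: "k holomorphic_on ball 0 1" and k0: "k 0 = 1"
    and kode: "\<And>z. z \<in> ball 0 1 \<Longrightarrow> 1 + z * deriv k z / k z = \<phi> z"
    and z: "z \<in> ball 0 1"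
  shows "Re ((k (of_real (- norm z)))\<^sup>2) \<le> (norm (H z))\<^sup>2"
    and "(norm (H z))\<^sup>2 \<le> Re ((k (of_real (norm z)))\<^sup>2)"
proof -
  have hol: "\<phi> holomorphic_on ball 0 1" and inj: "inj_on \<phi> (ball 0 1)"
    and sym: "\<And>w. w \<in> \<phi> ` ball 0 1 \<Longrightarrow> cnj w \<in> \<phi> ` ball 0 1"
    and \<phi>0: "\<phi> 0 = 1" "\<phi> 0 \<in> \<real>" and d\<phi>: "deriv \<phi> 0 \<in> \<real>" "Re (deriv \<phi> 0) > 0"
    using mm by (auto simp: ma_minda_def)
  note real_iff = univalent_real_iff[OF hol inj sym \<phi>0(2) d\<phi>(1)]
  have mono: "Re (\<phi> (of_real x)) \<le> Re (\<phi> (of_real y))" if "-1 < x" "x \<le> y" "y < 1" for x y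
    using strict_mono_on_leD[OF univalent_real_strict_mono[OF hol inj sym \<phi>0(2) d\<phi>], of x y] that by auto
  \<comment> \<open>Since \<open>x / 0 = 0\<close>, at a zero of \<open>k\<close> the equation
    \<open>kode\<close> reads \<open>\<phi> z = 1 = \<phi> 0\<close>. Injectivity then gives
    \<open>z = 0\<close>, where \<open>k\<close> equals 1.\<close>
  have knz: "k z \<noteq> 0" if "z \<in> ball 0 1" for z
  proof
    assume "k z = 0"
    then have "\<phi> z = \<phi> 0" using kode[OF that] \<phi>0 by simp
    then have "z = 0" using inj that by (simp add: inj_on_def)
    then show False using \<open>k z = 0\<close> k0 by simp
  qed
  obtain q where q: "q holomorphic_on ball 0 1" "q 0 = 0" "\<And>z. z \<in> ball 0 1 \<Longrightarrow> k z = exp (q z)"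
      "\<And>z. z \<in> ball 0 1 \<Longrightarrow> deriv q z = deriv k z / k z"
    using obtain_holomorphic_log[OF holk knz k0] by metis
  obtain p where p: "p holomorphic_on ball 0 1" "p 0 = 0" "\<And>z. z \<in> ball 0 1 \<Longrightarrow> H z = exp (p z)"
      "\<And>z. z \<in> ball 0 1 \<Longrightarrow> deriv p z = deriv H z / H z"
    using obtain_holomorphic_log[OF holH Hnz H0] by metis
  obtain \<omega> where \<omega>: "\<omega> holomorphic_on ball 0 1" "\<omega> ` ball 0 1 \<subseteq> ball 0 1" "\<omega> 0 = 0"
     "\<And>z. z \<in> ball 0 1 \<Longrightarrow> 1 + z * deriv H z / H z = \<phi> (\<omega> z)"
    using sub unfolding subordinate_def by auto
  have zq: "z * deriv q z = \<phi> z - 1" if "z \<in> ball 0 1" for z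
    using kode[OF that] q(4)[OF that] by (simp add: algebra_simps)
  have zp: "z * deriv p z = \<phi> (\<omega> z) - 1" if "z \<in> ball 0 1" for z
    using \<omega>(4)[OF that] p(4)[OF that] by (simp add: algebra_simps)
  have dq: "((\<lambda>t. q (of_real t)) has_vector_derivative (\<phi> (of_real t) - 1) / of_real t) (at t)"
    if "\<bar>t\<bar> < 1" "t \<noteq> 0" for t
  proof (rule has_vector_derivative_real_field)
    have "deriv q (of_real t) = (\<phi> (of_real t) - 1) / of_real t"
      using zq[of "of_real t"] that by (simp add: field_simps)
    then show "(q has_field_derivative (\<phi> (of_real t) - 1) / of_real t) (at (of_real t))"
      using holomorphic_derivI[OF q(1), of "of_real t"] that by simp
  qed
  have contq: "continuous_on {-1<..<1} (\<lambda>t. q (of_real t))"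
    by (intro continuous_intros continuous_on_compose2[OF holomorphic_on_imp_continuous_on[OF q(1)]]) auto
  have dReq: "((\<lambda>t. Re (q (of_real t))) has_real_derivative (Re (\<phi> (of_real t)) - 1) / t) (at t)"
    if "\<bar>t\<bar> < 1" "t \<noteq> 0" for t
    using dq[OF that] by (auto simp: has_vector_derivative_complex_iff)
  \<comment> \<open>The derivative of \<open>q\<close> along the real axis is real, so
    \<open>Im q\<close> has derivative zero there. That derivative is computed only away from 0;
    continuity at 0 joins each side to the value \<open>q 0 = 0\<close>.\<close>
  have Im_q: "Im (q (of_real t)) = 0" if t: "\<bar>t\<bar> < 1" for t
  proof -
    have "((\<lambda>t. Im (q (of_real t))) has_real_derivative 0) (at x)" if "\<bar>x\<bar> < 1" "x \<noteq> 0" for x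
    proof -
      have "\<phi> (of_real x) \<in> \<real>" using real_iff[of "of_real x"] that by auto
      then have "Im ((\<phi> (of_real x) - 1) / of_real x) = 0" by (simp add: complex_is_Real_iff)
      then show ?thesis using dq[OF that] by (simp only: has_vector_derivative_complex_iff)
    qed
    moreover have "continuous_on {-1<..<1} (\<lambda>t. Im (q (of_real t)))"
      by (intro continuous_intros contq)
    then have "continuous_on {0..t} (\<lambda>t. Im (q (of_real t)))" "continuous_on {t..0} (\<lambda>t. Im (q (of_real t)))"
      by (rule continuous_on_subset; use t in auto)+
    ultimately show ?thesis
      using DERIV_isconst_end[of 0 t "\<lambda>t. Im (q (of_real t))"]
        DERIV_isconst_end[of t 0 "\<lambda>t. Im (q (of_real t))"] t q(2)
      by (cases "t = 0"; cases "0 < t") auto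
  qed
  have k_sq: "Re ((k (of_real t))\<^sup>2) = exp (2 * Re (q (of_real t)))" if "\<bar>t\<bar> < 1" for t
  proof -
    have "k (of_real t) = exp (of_real (Re (q (of_real t))))"
      using q(3)[of "of_real t"] Im_q[OF that] that by (simp add: complex_is_Real_iff)
    then have "k (of_real t) = of_real (exp (Re (q (of_real t))))"
      by (simp add: exp_of_real)
    then show ?thesis
      by (metis Re_complex_of_real exp_double of_real_power)
  qed
  have H_sq: "(norm (H z))\<^sup>2 = exp (2 * Re (p z))"
    using p(3)[OF z] by (simp add: exp_double)
  \<comment> \<open>At a critical point of the comparison \<open>\<phi> (\<omega> w)\<close> is
    real, which forces \<open>\<omega> w\<close> onto the real diameter.\<close>
  have real_arg: "\<exists>x. \<omega> w = of_real x \<and> \<bar>x\<bar> \<le> norm w"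
    if w: "w \<in> ball 0 1" and "w * deriv p w \<in> \<real>" for w
  proof -
    have "\<phi> (\<omega> w) - 1 \<in> \<real>" using that zp by simp
    then have "\<phi> (\<omega> w) \<in> \<real>" by (simp add: complex_is_Real_iff)
    then have "\<omega> w \<in> \<real>" using real_iff[of "\<omega> w"] \<omega>(2) w by blast
    moreover have "norm (\<omega> w) \<le> norm w"
      using Schwarz_Lemma(1)[OF \<omega>(1,3)] \<omega>(2) w by (simp add: image_subset_iff)
    ultimately show ?thesis by (metis Reals_cases norm_of_real)
  qed
  have "Re (p z) \<le> Re (q (of_real (norm z)))"
  proof (rule Re_le_radial_majorant[OF p(1) _ _ _ _ z,
        where u = "\<lambda>t. Re (q (of_real t))" and c = "\<lambda>t. Re (\<phi> (of_real t)) - 1"])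
    show "Re (p 0) = Re (q (of_real 0))" using p q by simp
    show "continuous_on {0..<1} (\<lambda>t. Re (q (complex_of_real t)))"
      by (rule continuous_on_subset[of "{-1<..<1}"]) (intro continuous_intros contq, auto)
    show "Re (w * deriv p w) \<le> Re (\<phi> (of_real (norm w))) - 1"
      if w: "w \<in> ball 0 1" "w \<noteq> 0" "w * deriv p w \<in> \<real>" for w
    proof -
      obtain x where "\<omega> w = of_real x" "\<bar>x\<bar> \<le> norm w" using real_arg[OF w(1,3)] by auto
      then show ?thesis using mono[of x "norm w"] zp[OF w(1)] w(1) by auto
    qed
  qed (use dReq in auto)
  then show "(norm (H z))\<^sup>2 \<le> Re ((k (of_real (norm z)))\<^sup>2)"
    using H_sq k_sq[of "norm z"] z by simp
  \<comment> \<open>For the lower bound the majorant is \<open>- Re q\<close> reflected to the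
    negative radius; both the sign and the reflection enter its derivative, giving
    \<open>c t = 1 - Re (\<phi> (- t))\<close>.\<close>
  have "Re (- p z) \<le> - Re (q (of_real (- norm z)))"
  proof (rule Re_le_radial_majorant[OF _ _ _ _ _ z,
        where p = "\<lambda>z. - p z" and u = "\<lambda>t. - Re (q (of_real (- t)))" and c = "\<lambda>t. 1 - Re (\<phi> (of_real (- t)))"])
    show "(\<lambda>z. - p z) holomorphic_on ball 0 1" by (intro holomorphic_intros p)
    show "Re (- p 0) = - Re (q (of_real (- 0)))" using p q by simp
    show "continuous_on {0..<1} (\<lambda>t. - Re (q (complex_of_real (- t))))"
      by (intro continuous_intros continuous_on_compose2[OF contq]) auto
    show "((\<lambda>t. - Re (q (of_real (- t)))) has_real_derivative (1 - Re (\<phi> (of_real (- t)))) / t) (at t)"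
      if "0 < t" "t < 1" for t
    proof -
      have "((\<lambda>t. Re (q (of_real (- t)))) has_real_derivative (Re (\<phi> (of_real (- t))) - 1) / (- t) * (- 1)) (at t)"
        by (rule DERIV_chain2[where f = "\<lambda>t. Re (q (of_real t))"])
           (use dReq[of "- t"] that in \<open>auto intro!: derivative_eq_intros\<close>)
      from DERIV_minus[OF this] show ?thesis
        by (rule DERIV_cong) (use that in \<open>simp add: field_simps\<close>)
    qed
    show "Re (w * deriv (\<lambda>z. - p z) w) \<le> 1 - Re (\<phi> (of_real (- norm w)))"
      if w: "w \<in> ball 0 1" "w \<noteq> 0" "w * deriv (\<lambda>z. - p z) w \<in> \<real>" for w
    proof -
      have d: "deriv (\<lambda>z. - p z) w = - deriv p w"
        using holomorphic_derivI[OF p(1) _ w(1)] by (intro DERIV_imp_deriv DERIV_minus) auto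
      then have "w * deriv p w \<in> \<real>" using w(3) by (simp add: complex_is_Real_iff)
      then obtain x where "\<omega> w = of_real x" "\<bar>x\<bar> \<le> norm w" using real_arg[OF w(1)] by auto
      then show ?thesis using mono[of "- norm w" x] zp[OF w(1)] w(1) d by auto
    qed
  qed
  then show "Re ((k (of_real (- norm z)))\<^sup>2) \<le> (norm (H z))\<^sup>2"
    using H_sq k_sq[of "- norm z"] z by simp
qed

section \<open>Convexity and univalence\<close>

lemma holomorphic_inverse_derivative:
  assumes "h holomorphic_on S" "open S" "inj_on h S"
  obtains k where "\<And>z. z \<in> S \<Longrightarrow> k (h z) = z" "continuous_on (h ` S) k"
    "\<And>w. w \<in> h ` S \<Longrightarrow> (k has_field_derivative 1 / deriv h (k w)) (at w)"
proof -
  obtain k where hk: "k holomorphic_on h ` S" and dk: "\<And>z. z \<in> S \<Longrightarrow> deriv h z * deriv k (h z) = 1"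
    and kh: "\<And>z. z \<in> S \<Longrightarrow> k (h z) = z"
    using holomorphic_has_inverse[OF assms] by auto
  have opn: "open (h ` S)" by (rule open_mapping_thm3[OF assms])
  have "(k has_field_derivative 1 / deriv h (k w)) (at w)" if "w \<in> h ` S" for w
  proof -
    obtain z where z: "z \<in> S" "w = h z" using \<open>w \<in> h ` S\<close> by (elim imageE)
    have "deriv k w = 1 / deriv h (k w)"
      using dk[OF z(1)] kh[OF z(1)] z(2) by (simp add: eq_divide_eq mult.commute) (metis mult_zero_left zero_neq_one)
    then show ?thesis using holomorphic_derivI[OF hk opn that] by simp
  qed
  then show ?thesis using that kh holomorphic_on_imp_continuous_on[OF hk] by blast
qed

text \<open>
  If \<open>h \<circ> \<gamma>\<close> is affine, then \<open>\<gamma>'' = - \<gamma>'\<^sup>2 s\<close> with \<open>s = h'' / h'\<close>. With \<open>g = \<gamma>\<close> and \<open>v = \<gamma>'\<close>, the left-hand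
  side is half the second derivative of \<open>|\<gamma>|\<^sup>2\<close> at a critical point.
\<close>

lemma Re_second_derivative_norm_square:
  fixes g v s :: complex
  assumes "Re (cnj g * v) = 0"
  shows "Re (cnj v * v - cnj g * (v\<^sup>2 * s)) = (norm v)\<^sup>2 * Re (1 + g * s)"
proof -
  have "cnj g * v = - (g * cnj v)"
    using assms by (auto simp: complex_eq_iff)
  then have "cnj g * (v\<^sup>2 * s) = - (cnj v * v) * (g * s)"
    by (simp add: power2_eq_square mult.assoc[symmetric])
  moreover have "cnj v * v = of_real ((norm v)\<^sup>2)"
    by (metis complex_norm_square mult.commute)
  ultimately have "cnj v * v - cnj g * (v\<^sup>2 * s) = (norm v)\<^sup>2 *\<^sub>R (1 + g * s)"
    by (simp add: scaleR_conv_of_real algebra_simps)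
  then show ?thesis by simp
qed

text \<open>Pull the segment back to a curve \<open>\<gamma>\<close> by the inverse of
  \<open>h\<close>. If \<open>\<gamma>\<close> touched the circle of radius \<open>R\<close>, its
  squared modulus would have an interior maximum; but at every such critical point
  \<open>pos\<close> makes the second derivative positive.\<close>

lemma segment_in_image_ball:
  assumes holh: "h holomorphic_on ball 0 1" and injh: "inj_on h (ball 0 1)"
    and pos: "\<And>z. z \<in> ball 0 1 \<Longrightarrow> Re (1 + z * deriv (deriv h) z / deriv h z) > 0"
    and R: "R < 1"
    and cl: "\<And>u. u \<in> {0..1} \<Longrightarrow> a + of_real u * d \<in> h ` cball 0 R"
    and ends: "a \<in> h ` ball 0 R" "a + d \<in> h ` ball 0 R"
    and t: "t \<in> {0..1}"
  shows "a + of_real t * d \<in> h ` ball 0 R"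
proof -
  obtain k where kh: "\<And>z. z \<in> ball 0 1 \<Longrightarrow> k (h z) = z" and contk: "continuous_on (h ` ball 0 1) k"
    and dk: "\<And>w. w \<in> h ` ball 0 1 \<Longrightarrow> (k has_field_derivative 1 / deriv h (k w)) (at w)"
    using holomorphic_inverse_derivative[OF holh open_ball injh] by metis
  have dh_nz: "deriv h z \<noteq> 0" if "z \<in> ball 0 1" for z
    by (rule holomorphic_injective_imp_regular[OF holh open_ball injh that])
  have sub: "cball 0 R \<subseteq> ball (0::complex) 1" using R by auto
  have img: "a + of_real u * d \<in> h ` ball 0 1" if "u \<in> {0..1}" for u
    using cl[OF that] sub by blast
  define \<gamma> where "\<gamma> = (\<lambda>u::real. k (a + of_real u * d))"
  have \<gamma>: "norm (\<gamma> u) \<le> R" "h (\<gamma> u) = a + of_real u * d" if u: "u \<in> {0..1}" for u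
  proof -
    obtain z where "z \<in> cball 0 R" "a + of_real u * d = h z" using cl[OF u] by (elim imageE)
    then show "norm (\<gamma> u) \<le> R" "h (\<gamma> u) = a + of_real u * d"
      using kh sub by (auto simp: \<gamma>_def subset_iff)
  qed
  have cont: "continuous_on {0..1} \<gamma>" unfolding \<gamma>_def
    by (rule continuous_on_compose2[OF contk]) (auto intro!: continuous_intros img)
  obtain u0 where u0: "u0 \<in> {0..1}" and max: "\<And>u. u \<in> {0..1} \<Longrightarrow> (norm (\<gamma> u))\<^sup>2 \<le> (norm (\<gamma> u0))\<^sup>2"
    using continuous_attains_sup[OF compact_Icc _ continuous_on_power[OF continuous_on_norm[OF cont], of 2]]
    by auto
  have "norm (\<gamma> u0) < R"
  proof (rule ccontr)
    assume "\<not> norm (\<gamma> u0) < R"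
    then have nu0: "norm (\<gamma> u0) = R" using \<gamma>(1)[OF u0] by simp
    have "a + of_real u0 * d \<notin> h ` ball 0 R"
    proof
      assume "a + of_real u0 * d \<in> h ` ball 0 R"
      then obtain z where z: "z \<in> ball 0 R" "a + of_real u0 * d = h z" by (elim imageE)
      have "\<gamma> u0 = z" using kh[of z] z R by (auto simp: \<gamma>_def)
      then show False using z nu0 by simp
    qed
    \<comment> \<open>The endpoints lie in the open image, so the touching parameter is interior.
      The segment is nondegenerate, for otherwise each of its points would be the endpoint
      \<open>a\<close>.\<close>
    then have "u0 \<noteq> 0" "u0 \<noteq> 1" and d: "d \<noteq> 0" using ends by auto
    then have u01: "0 < u0" "u0 < 1" using u0 by auto
    have \<gamma>b: "\<gamma> u \<in> ball 0 1" if "u \<in> {0..1}" for u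
      using \<gamma>(1)[OF that] R by auto
    define v where "v = (\<lambda>u. d / deriv h (\<gamma> u))"
    have d\<gamma>: "(\<gamma> has_vector_derivative v u) (at u)" if "u \<in> {0..1}" for u
      unfolding \<gamma>_def
    proof (rule has_vector_derivative_real_field)
      show "((\<lambda>u. k (a + u * d)) has_field_derivative v u) (at (of_real u))"
        unfolding v_def \<gamma>_def
        by (rule DERIV_cong, rule DERIV_chain2[where f = k and g = "\<lambda>u. a + u * d", OF dk[OF img[OF that]]])
           (auto intro!: derivative_eq_intros)
    qed
    define D where "D = (\<lambda>u. Re (cnj (\<gamma> u) * v u))"
    have dm: "((\<lambda>u. (norm (\<gamma> u))\<^sup>2) has_real_derivative 2 * D u) (at u)" if "u \<in> {0..1}" for u
    proof -
      have "((\<lambda>u. (Re (\<gamma> u))\<^sup>2 + (Im (\<gamma> u))\<^sup>2) has_real_derivative 2 * D u) (at u)"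
        using d\<gamma>[OF that] unfolding has_vector_derivative_complex_iff
        by (elim conjE, intro DERIV_cong[OF DERIV_add[OF DERIV_power DERIV_power]]) (auto simp: D_def)
      then show ?thesis by (simp add: cmod_power2)
    qed
    have D0: "D u0 = 0"
    proof -
      have "2 * D u0 = 0"
      proof (rule DERIV_local_max[OF dm[OF u0], where d = "min u0 (1 - u0)"])
        show "\<forall>y. \<bar>u0 - y\<bar> < min u0 (1 - u0) \<longrightarrow> (norm (\<gamma> y))\<^sup>2 \<le> (norm (\<gamma> u0))\<^sup>2"
          by (intro allI impI max) auto
      qed (use u01 in auto)
      then show ?thesis by simp
    qed
    let ?s = "deriv (deriv h) (\<gamma> u0) / deriv h (\<gamma> u0)"
    have dv: "(v has_vector_derivative - ((v u0)\<^sup>2 * ?s)) (at u0)"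
    proof -
      have hol': "deriv h holomorphic_on ball 0 1" using holh by (intro holomorphic_deriv) auto
      have "(deriv h has_field_derivative deriv (deriv h) (\<gamma> u0)) (at (\<gamma> u0))"
        by (rule holomorphic_derivI[OF hol' _ \<gamma>b[OF u0]]) auto
      then have "((\<lambda>z. d / deriv h z) has_field_derivative
          - (d * deriv (deriv h) (\<gamma> u0) / (deriv h (\<gamma> u0))\<^sup>2)) (at (\<gamma> u0))"
        using dh_nz[OF \<gamma>b[OF u0]] by (auto intro!: derivative_eq_intros simp: power2_eq_square)
      from field_vector_diff_chain_at[OF d\<gamma>[OF u0] this]
      show ?thesis
        unfolding v_def o_def by (rule has_vector_derivative_eq_rhs) (simp add: power2_eq_square mult.assoc)
    qed
    have "(D has_real_derivative Re (cnj (v u0) * v u0 + cnj (\<gamma> u0) * (- ((v u0)\<^sup>2 * ?s)))) (at u0)"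
    proof -
      have "((\<lambda>u. cnj (\<gamma> u) * v u) has_vector_derivative
          (cnj (\<gamma> u0) * (- ((v u0)\<^sup>2 * ?s)) + cnj (v u0) * v u0)) (at u0)"
        by (rule has_vector_derivative_mult[OF has_vector_derivative_cnj[OF d\<gamma>[OF u0]] dv])
      then show ?thesis unfolding D_def
        by (simp only: has_vector_derivative_complex_iff add.commute)
    qed
    moreover have "Re (cnj (v u0) * v u0 + cnj (\<gamma> u0) * (- ((v u0)\<^sup>2 * ?s))) =
        (norm (v u0))\<^sup>2 * Re (1 + \<gamma> u0 * ?s)"
      using Re_second_derivative_norm_square[of "\<gamma> u0" "v u0" ?s] D0 by (simp add: D_def)
    moreover have "(norm (v u0))\<^sup>2 * Re (1 + \<gamma> u0 * ?s) > 0"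
      using pos[OF \<gamma>b[OF u0]] d dh_nz[OF \<gamma>b[OF u0]] by (intro mult_pos_pos) (auto simp: v_def)
    \<comment> \<open>\<open>D\<close> is half the derivative of the squared modulus. It vanishes at
      \<open>u0\<close> and increases there, so it is positive just to the right, and the squared
      modulus rises above its maximum.\<close>
    ultimately obtain e where e: "e > 0" "\<And>x. 0 < x \<Longrightarrow> x < e \<Longrightarrow> D u0 < D (u0 + x)"
      using DERIV_pos_inc_right[of D _ u0] by metis
    define x where "x = u0 + min e (1 - u0) / 2"
    have x: "u0 < x" "x < 1" "x < u0 + e" using e(1) u01 by (auto simp: x_def min_def field_simps)
    have "(norm (\<gamma> u0))\<^sup>2 < (norm (\<gamma> x))\<^sup>2"
    proof (rule DERIV_pos_imp_increasing_open[OF x(1)])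
      fix y assume y: "u0 < y" "y < x"
      then have "D y > 0" using e(2)[of "y - u0"] x D0 by auto
      then show "\<exists>l. ((\<lambda>u. (norm (\<gamma> u))\<^sup>2) has_real_derivative l) (at y) \<and> l > 0"
        using dm[of y] y x u01 by (intro exI[of _ "2 * D y"]) auto
    qed (intro continuous_intros continuous_on_subset[OF cont], use u01 x in auto)
    moreover have "(norm (\<gamma> x))\<^sup>2 \<le> (norm (\<gamma> u0))\<^sup>2" by (rule max) (use x u01 in auto)
    ultimately show False by linarith
  qed
  moreover have "norm (\<gamma> t) \<le> norm (\<gamma> u0)" using max[OF t] by simp
  ultimately show ?thesis using \<gamma>(2)[OF t] by (intro image_eqI[of _ _ "\<gamma> t"]) auto
qed

text \<open>
  The segment from \<open>h (t x)\<close> to \<open>h (t y)\<close> lies in \<open>h ` ball 0 R\<close> for \<open>t = 0\<close>; the set \<open>A\<close> of all such \<open>t\<close>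
  is closed because a segment in the closure cannot touch the boundary, and its complement \<open>B\<close> is closed
  as a projection of a compact set.
\<close>

lemma convex_image_ball:
  assumes holh: "h holomorphic_on ball 0 1" and injh: "inj_on h (ball 0 1)"
    and pos: "\<And>z. z \<in> ball 0 1 \<Longrightarrow> Re (1 + z * deriv (deriv h) z / deriv h z) > 0"
    and R: "R < 1"
  shows "convex (h ` ball 0 R)"
proof -
  have sub: "cball 0 R \<subseteq> ball (0::complex) 1" "ball 0 R \<subseteq> ball (0::complex) 1" using R by auto
  have conth: "continuous_on (ball 0 1) h" by (rule holomorphic_on_imp_continuous_on[OF holh])
  have "h x + of_real u * (h y - h x) \<in> h ` ball 0 R"
    if xy: "x \<in> ball 0 R" "y \<in> ball 0 R" and u: "u \<in> {0..1}" for x y u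
  proof -
    \<comment> \<open>Shrinking \<open>x\<close> and \<open>y\<close> by the factor \<open>t\<close>
      deforms the given segment, at \<open>t = 1\<close>, to the single point \<open>h 0\<close>, at
      \<open>t = 0\<close>.\<close>
    define s where "s = (\<lambda>t u. h (of_real t * x) + of_real u * (h (of_real t * y) - h (of_real t * x)))"
    have in_ball: "of_real t * z \<in> ball 0 R" if "t \<in> {0..1}" "z \<in> ball 0 R" for t and z :: complex
      using that mult_left_le_one_le[of "norm z" t] by (auto simp: norm_mult)
    have in_ball': "of_real t * z \<in> ball 0 1" if "t \<in> {0..1}" "z \<in> ball 0 R" for t and z :: complex
      using in_ball[OF that] sub by blast
    have conts: "continuous_on ({0..1} \<times> {0..1}) (\<lambda>(t, u). s t u)"
      unfolding s_def case_prod_beta using xy in_ball'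
      by (intro continuous_intros continuous_on_compose2[OF conth]) auto
    define A where "A = {t \<in> {0..1}. \<forall>u\<in>{0..1}. s t u \<in> h ` cball 0 R}"
    define B where "B = fst ` (({0..1} \<times> {0..1}) \<inter> (\<lambda>(t, u). s t u) -` (- h ` ball 0 R))"
    \<comment> \<open>\<open>A\<close> asks only for the closed disc, which makes it closed; the
      preceding lemma upgrades this to the open disc, which makes \<open>A\<close> disjoint from
      \<open>B\<close>.\<close>
    have A_iff: "s t u \<in> h ` ball 0 R" if t: "t \<in> A" and "u \<in> {0..1}" for t u
      unfolding s_def
    proof (rule segment_in_image_ball[OF holh injh pos R])
      show "h (of_real t * x) \<in> h ` ball 0 R"
        "h (of_real t * x) + (h (of_real t * y) - h (of_real t * x)) \<in> h ` ball 0 R"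
        using t xy in_ball by (auto simp: A_def)
    qed (use t that in \<open>auto simp: A_def s_def\<close>)
    have "compact (h ` cball 0 R)"
      by (intro compact_continuous_image continuous_on_subset[OF conth] sub) auto
    then have "closed (h ` cball 0 R)" by (rule compact_imp_closed)
    have "closed ({0..1} \<inter> (\<lambda>t. s t u) -` (h ` cball 0 R))" if "u \<in> {0..1}" for u
      by (rule continuous_closed_preimage[OF continuous_on_compose2[OF conts, of _ "\<lambda>t. (t, u)", simplified]])
         (use that \<open>closed (h ` cball 0 R)\<close> in \<open>auto intro!: continuous_intros\<close>)
    then have "closed (\<Inter>u\<in>{0..1}. {0..1} \<inter> (\<lambda>t. s t u) -` (h ` cball 0 R))"
      by blast
    moreover have "A = (\<Inter>u\<in>{0..1}. {0..1} \<inter> (\<lambda>t. s t u) -` (h ` cball 0 R))"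
      by (auto simp: A_def)
    ultimately have clA: "closed A" by simp
    have "open (h ` ball 0 R)"
      by (rule open_mapping_thm3) (use holh injh sub in \<open>auto intro: holomorphic_on_subset inj_on_subset\<close>)
    then have "closed (({0..1} \<times> {0..1}) \<inter> (\<lambda>(t, u). s t u) -` (- h ` ball 0 R))"
      by (intro continuous_closed_preimage[OF conts] closed_Times) auto
    then have "compact (({0..1} \<times> {0..1}) \<inter> (\<lambda>(t, u). s t u) -` (- h ` ball 0 R))"
      using closed_Int_compact[OF _ compact_Times[of "{0..1::real}" "{0..1::real}"]]
      by (metis Int_absorb1 Int_commute compact_Icc inf_le1)
    then have clB: "closed B"
      unfolding B_def by (intro compact_imp_closed compact_continuous_image) (auto intro!: continuous_intros)
    have "A \<inter> B \<inter> {0..1} = {}" using A_iff by (auto simp: B_def)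
    moreover have "{0..1} \<subseteq> A \<union> B"
    proof
      fix t :: real assume t: "t \<in> {0..1}"
      show "t \<in> A \<union> B"
      proof (rule ccontr)
        assume n: "t \<notin> A \<union> B"
        then obtain u where u: "u \<in> {0..1}" "s t u \<notin> h ` cball 0 R" using t by (auto simp: A_def)
        then have "s t u \<notin> h ` ball 0 R" using ball_subset_cball by blast
        then have "t \<in> B" unfolding B_def using u t by (intro image_eqI[of _ _ "(t, u)"]) auto
        then show False using n by simp
      qed
    qed
    moreover have "0 \<in> A" using xy le_less_trans[OF norm_ge_zero, of x R] by (auto simp: A_def s_def intro!: imageI)
    \<comment> \<open>Two disjoint closed sets cover the connected unit interval and the first is
      nonempty, so the second misses the interval.\<close>
    ultimately have "B \<inter> {0..1} = {}"
      using connected_Icc[of 0 "1::real"] clA clB unfolding connected_closed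
      by (metis IntI atLeastAtMost_iff empty_iff order_refl zero_le_one)
    moreover have "(1::real) \<in> {0..1}" by simp
    ultimately have "1 \<in> A" using \<open>{0..1} \<subseteq> A \<union> B\<close> by blast
    then show ?thesis using A_iff[OF _ u, of 1] by (simp add: s_def)
  qed
  note * = this
  show ?thesis
  proof (rule convexI)
    fix a b :: complex and u v :: real
    assume ab: "a \<in> h ` ball 0 R" "b \<in> h ` ball 0 R" and uv: "0 \<le> u" "0 \<le> v" "u + v = 1"
    obtain x y where xy: "x \<in> ball 0 R" "y \<in> ball 0 R" "a = h x" "b = h y" using ab by (elim imageE)
    have "u *\<^sub>R a + v *\<^sub>R b = h x + of_real v * (h y - h x)"
    proof -
      have "u = 1 - v" using uv by linarith
      show ?thesis by (simp add: \<open>u = 1 - v\<close> xy scaleR_conv_of_real algebra_simps)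
    qed
    then show "u *\<^sub>R a + v *\<^sub>R b \<in> h ` ball 0 R" using *[OF xy(1,2), of v] uv by simp
  qed
qed

text \<open>Equal values at \<open>x\<close> and \<open>y\<close> make \<open>h x - h y\<close> and
  \<open>g x - g y\<close> equal in modulus, whereas the contraction bound makes the latter at most
  \<open>R < 1\<close> times the former; so both vanish.\<close>

lemma harmonic_convex_inj:
  assumes holh: "h holomorphic_on ball 0 1" and injh: "inj_on h (ball 0 1)"
    and pos: "\<And>z. z \<in> ball 0 1 \<Longrightarrow> Re (1 + z * deriv (deriv h) z / deriv h z) > 0"
    and holg: "g holomorphic_on ball 0 1"
    and dg: "\<And>z. z \<in> ball 0 1 \<Longrightarrow> norm (deriv g z) \<le> norm z * norm (deriv h z)"
  shows "inj_on (\<lambda>z. h z + cnj (g z)) (ball 0 1)"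
proof (rule inj_onI)
  fix x y assume xy: "x \<in> ball 0 1" "y \<in> ball 0 1" and eq: "h x + cnj (g x) = h y + cnj (g y)"
  \<comment> \<open>Halfway between the larger modulus and 1: the disc contains both points, and
    \<open>R\<close> is a contraction constant below 1.\<close>
  define R where "R = (1 + max (norm x) (norm y)) / 2"
  have R: "R < 1" "norm x < R" "norm y < R" "0 < R"
    using xy by (auto simp: R_def field_simps max_def add_pos_nonneg)
  have sub: "ball 0 R \<subseteq> ball (0::complex) 1" using R by auto
  obtain k where kh: "\<And>z. z \<in> ball 0 1 \<Longrightarrow> k (h z) = z"
    and dk: "\<And>w. w \<in> h ` ball 0 1 \<Longrightarrow> (k has_field_derivative 1 / deriv h (k w)) (at w)"
    using holomorphic_inverse_derivative[OF holh open_ball injh] by metis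
  \<comment> \<open>Mean value inequality for \<open>g\<close> after the inverse of
    \<open>h\<close>, on the convex image of the disc. The derivative is
    \<open>deriv g / deriv h\<close>, bounded by \<open>norm z < R\<close>.\<close>
  have "norm (g (k (h x)) - g (k (h y))) \<le> R * norm (h x - h y)"
  proof (rule field_differentiable_bound[OF convex_image_ball[OF holh injh pos R(1)]])
    fix w assume "w \<in> h ` ball 0 R"
    then obtain z where z: "z \<in> ball 0 R" "w = h z" by (elim imageE)
    then have z1: "z \<in> ball 0 1" and kw: "k w = z" using kh sub by auto
    have nz: "deriv h z \<noteq> 0"
      by (rule holomorphic_injective_imp_regular[OF holh open_ball injh z1])
    have "(g has_field_derivative deriv g z) (at (k w))"
      using holomorphic_derivI[OF holg open_ball z1] kw by simp
    from DERIV_chain2[OF this dk[of w]] z1 z(2) kw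
    show "((\<lambda>w. g (k w)) has_field_derivative deriv g (k w) * (1 / deriv h (k w))) (at w within h ` ball 0 R)"
      by (auto intro: has_field_derivative_at_within)
    have "norm (deriv g z) \<le> R * norm (deriv h z)"
      using dg[OF z1] z by (smt (verit) dist_0_norm mem_ball mult_right_mono norm_ge_zero)
    then show "norm (deriv g (k w) * (1 / deriv h (k w))) \<le> R"
      using nz kw by (simp add: norm_mult norm_divide field_simps)
  qed (use R in auto)
  then have "norm (g x - g y) \<le> R * norm (h x - h y)" using kh xy by simp
  moreover have "h x - h y = - cnj (g x - g y)" using eq by (simp add: algebra_simps)
  then have "norm (h x - h y) = norm (g x - g y)" by (metis complex_mod_cnj norm_minus_cancel)
  ultimately have "(1 - R) * norm (h x - h y) \<le> 0" by (simp add: algebra_simps)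
  then have "h x = h y" using R by (simp add: mult_le_0_iff)
  then show "x = y" using injh xy by (simp add: inj_on_def)
qed

section \<open>Area in polar coordinates\<close>

definition vec2_complex :: "real^2 \<Rightarrow> complex" where
  "vec2_complex x = Complex (x $ 1) (x $ 2)"

definition complex_vec2 :: "complex \<Rightarrow> real^2" where
  "complex_vec2 z = vector [Re z, Im z]"

lemma vec2_complex_inverse [simp]: "complex_vec2 (vec2_complex x) = x"
  by (simp add: complex_vec2_def vec2_complex_def vec_eq_iff forall_2)

lemma complex_vec2_inverse [simp]: "vec2_complex (complex_vec2 z) = z"
  by (simp add: complex_vec2_def vec2_complex_def complex_eq_iff)

lemma bounded_linear_complex_vec2: "bounded_linear complex_vec2"
  unfolding linear_conv_bounded_linear[symmetric]
  by (rule linearI) (simp_all add: complex_vec2_def vec_eq_iff forall_2)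

lemma bounded_linear_vec2_complex: "bounded_linear vec2_complex"
  unfolding linear_conv_bounded_linear[symmetric]
  by (rule linearI) (simp_all add: vec2_complex_def complex_eq_iff)

lemma Basis_vec2: "(Basis :: (real^2) set) = {axis 1 1, axis 2 1}"
  by (auto simp: Basis_vec_def UNIV_2)

text \<open>The change of variables is carried out in \<open>real^2\<close>, so areas have to be
  carried over to \<open>complex\<close>. Lebesgue measure is determined by boxes, and the
  identification sends boxes to boxes with the same side lengths.\<close>

lemma lborel_distr_vec2_complex: "distr lborel borel vec2_complex = lborel"
proof (rule lborel_eqI[symmetric])
  fix l u :: complex assume le: "\<And>b. b \<in> Basis \<Longrightarrow> l \<bullet> b \<le> u \<bullet> b"
  have m: "vec2_complex \<in> borel_measurable borel"
    by (intro borel_measurable_continuous_onI linear_continuous_on bounded_linear_vec2_complex)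
  have vim: "vec2_complex -` box l u = box (complex_vec2 l) (complex_vec2 u)"
    by (auto simp: mem_box_cart forall_2 complex_vec2_def vec2_complex_def mem_box Basis_complex_def)
  have le2: "complex_vec2 l \<bullet> b \<le> complex_vec2 u \<bullet> b" if "b \<in> Basis" for b
    using that le[of 1] le[of \<i>]
    by (auto simp: Basis_vec2 Basis_complex_def inner_axis complex_vec2_def)
  have "emeasure (distr lborel borel vec2_complex) (box l u) = emeasure lborel (box (complex_vec2 l) (complex_vec2 u))"
    using m by (subst emeasure_distr) (auto simp: vim)
  also have "\<dots> = (\<Prod>b\<in>Basis. (complex_vec2 u - complex_vec2 l) \<bullet> b)"
    by (rule emeasure_lborel_box[OF le2])
  also have "(\<Prod>b\<in>Basis. (complex_vec2 u - complex_vec2 l) \<bullet> b) = (\<Prod>b\<in>Basis. (u - l) \<bullet> b)"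
  proof -
    have "axis 1 1 \<noteq> (axis 2 1 :: real^2)" by (simp add: axis_eq_axis)
    then show ?thesis
      by (simp add: Basis_vec2 Basis_complex_def inner_axis complex_vec2_def)
  qed
  finally show "emeasure (distr lborel borel vec2_complex) (box l u) = (\<Prod>b\<in>Basis. (u - l) \<bullet> b)" .
qed simp

text \<open>Open sets are Borel, so the completed measure agrees with \<open>lborel\<close> on both
  sides and the previous identity of measures applies.\<close>

lemma measure_lebesgue_complex_vec2:
  assumes "open S"
  shows "measure lebesgue (complex_vec2 ` S) = measure lebesgue S"
proof -
  have m: "vec2_complex \<in> borel_measurable borel"
    by (intro borel_measurable_continuous_onI linear_continuous_on bounded_linear_vec2_complex)
  have eq: "complex_vec2 ` S = vec2_complex -` S"
    by (auto simp: image_iff) (metis vec2_complex_inverse)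
  have "open (vec2_complex -` S)"
    using assms by (intro open_vimage linear_continuous_on bounded_linear_vec2_complex)
  then have "measure lebesgue (complex_vec2 ` S) = measure lborel (vec2_complex -` S)"
    unfolding eq by (intro measure_completion) auto
  also have "\<dots> = measure (distr lborel borel vec2_complex) S"
    using m assms by (subst measure_distr) auto
  also have "\<dots> = measure lebesgue S"
    unfolding lborel_distr_vec2_complex using assms by (intro measure_completion[symmetric]) auto
  finally show ?thesis .
qed

text \<open>Fubini for \<open>real^2\<close>: the integral is transported to
  \<open>real \<times> real\<close>, where the iterated integral of a continuous function is
  available.\<close>

lemma integral_vec2_prod:
  fixes f :: "real^2 \<Rightarrow> real"
  assumes cont: "continuous_on (cbox a b) f"
  shows "integral (cbox a b) f =
    integral {a$1..b$1} (\<lambda>x. integral {a$2..b$2} (\<lambda>y. f (vector [x, y])))"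
proof -
  let ?g = "\<lambda>p::real \<times> real. vector [fst p, snd p] :: real^2" and ?h = "\<lambda>v::real^2. (v $ 1, v $ 2)"
  have lin: "bounded_linear ?g"
    unfolding linear_conv_bounded_linear[symmetric]
    by (rule linearI) (simp_all add: vec_eq_iff forall_2)
  have mem: "p \<in> cbox u v \<longleftrightarrow> ?g p \<in> cbox (?g u) (?g v)" for p u v
    by (cases p; cases u; cases v) (auto simp: cbox_Pair_eq mem_box_cart forall_2)
  have gh: "?g (?h x) = x" for x by (simp add: vec_eq_iff forall_2)
  have g_img: "?g ` cbox u v = cbox (?g u) (?g v)" for u v
  proof (intro equalityI subsetI)
    fix x assume "x \<in> cbox (?g u) (?g v)"
    then have "?h x \<in> cbox u v" using mem[of "?h x" u v] gh[of x] by simp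
    then show "x \<in> ?g ` cbox u v" by (rule image_eqI[rotated]) (simp add: gh[simplified])
  next
    fix x assume "x \<in> ?g ` cbox u v"
    then obtain p where "p \<in> cbox u v" "x = ?g p" by (elim imageE)
    then show "x \<in> cbox (?g u) (?g v)" using mem[of p u v] by (simp only:)
  qed
  have h_img: "?h ` cbox u v = cbox (?h u) (?h v)" for u v
  proof (intro equalityI subsetI)
    fix p assume "p \<in> cbox (?h u) (?h v)"
    then have "?g p \<in> cbox u v" using mem[of p "?h u" "?h v"] gh by simp
    then show "p \<in> ?h ` cbox u v" by (rule image_eqI[rotated]) simp
  next
    fix p assume "p \<in> ?h ` cbox u v"
    then show "p \<in> cbox (?h u) (?h v)" by (auto simp: cbox_Pair_eq mem_box_cart)
  qed
  \<comment> \<open>The factor \<open>1 / 1\<close> records that relabelling coordinates preserves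
    the content of boxes.\<close>
  have "((\<lambda>p. f (?g p)) has_integral (1 / 1) *\<^sub>R integral (cbox a b) f) (?h ` cbox a b)"
  proof (rule has_integral_twiddle[where g = ?g])
    show "continuous (at x) ?g" for x by (rule linear_continuous_at[OF lin])
    show "measure lborel (?g ` cbox u v) = 1 * measure lborel (cbox u v)" for u v
    proof (cases "cbox u v = {}")
      case False
      then have "cbox (?g u) (?g v) \<noteq> {}" unfolding g_img[symmetric] by simp
      moreover obtain u1 u2 v1 v2 where uv: "u = (u1, u2)" "v = (v1, v2)" by fastforce
      moreover have "u1 \<le> v1 \<and> u2 \<le> v2" using False by (auto simp: uv cbox_Pair_eq)
      ultimately show ?thesis
        unfolding g_img by (simp add: content_cbox_cart content_Pair UNIV_2)
    qed simp
  qed (use g_img h_img integrable_continuous[OF cont] in \<open>auto simp: vec_eq_iff forall_2 intro: integrable_integral\<close>)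
  then have "integral (cbox (a$1, a$2) (b$1, b$2)) (\<lambda>p. f (?g p)) = integral (cbox a b) f"
    by (simp add: h_img integral_unique)
  moreover have "continuous_on (cbox (a$1, a$2) (b$1, b$2)) (\<lambda>p. f (?g p))"
    by (intro continuous_on_compose2[OF cont] linear_continuous_on[OF lin])
       (auto simp: forall_2 mem_box_cart cbox_Pair_eq)
  ultimately show ?thesis
    using integral_prod_continuous[of "a$1" "a$2" "b$1" "b$2" "\<lambda>p. f (?g p)"] by simp
qed

text \<open>Jacobian of a harmonic map in polar coordinates: \<open>a + cnj b\<close> is the radial
  derivative and the other vector the angular one, where \<open>a\<close> and \<open>b\<close> are
  the two complex derivatives multiplied by the unit vector of direction.\<close>

lemma det_real_linear_complex:
  "Re (a + cnj b) * Im (\<i> * t * a + cnj (\<i> * t * b)) - Re (\<i> * t * a + cnj (\<i> * t * b)) * Im (a + cnj b)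
   = t * ((norm a)\<^sup>2 - (norm b)\<^sup>2)" for t :: real
  unfolding cmod_power2 by (simp add: power2_eq_square algebra_simps)

text \<open>\<open>A\<close> and \<open>B\<close> stand for the derivatives of the analytic and the
  co-analytic part. Polar coordinates map an open box bijectively onto the slit disc, the slit
  contributes no area, and \<open>le\<close> makes the Jacobian nonnegative.\<close>

lemma measure_image_ball_polar:
  fixes f A B :: "complex \<Rightarrow> complex"
  assumes df: "\<And>z. z \<in> ball 0 1 \<Longrightarrow> (f has_derivative (\<lambda>v. A z * v + cnj (B z * v))) (at z)"
    and contA: "continuous_on (ball 0 1) A" and contB: "continuous_on (ball 0 1) B"
    and inj: "inj_on f (ball 0 1)"
    and le: "\<And>z. z \<in> ball 0 1 \<Longrightarrow> norm (B z) \<le> norm (A z)"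
    and r: "0 < r" "r < 1"
  shows "measure lebesgue (f ` ball 0 r) =
    integral {0..r} (\<lambda>t. integral {-pi..pi}
      (\<lambda>\<theta>. t * ((norm (A (rcis t \<theta>)))\<^sup>2 - (norm (B (rcis t \<theta>)))\<^sup>2)))"
proof -
  have rcis_eq: "rcis t \<theta> = of_real t * exp (\<i> * of_real \<theta>)" for t \<theta>
    by (simp add: rcis_def cis_conv_exp)
  \<comment> \<open>The slit holds the origin and the points with \<open>Arg z = pi\<close>; off it,
    modulus and argument fill exactly the open box.\<close>
  define neg where "neg = {z \<in> ball (0::complex) r. Im z = 0 \<and> Re z \<le> 0}"
  have sub: "ball 0 r \<subseteq> ball (0::complex) 1" using r by auto
  have contf: "continuous_on (ball 0 1) f"
    using df by (meson continuous_at_imp_continuous_on has_derivative_continuous)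
  have "negligible {z :: complex. \<i> \<bullet> z = 0}"
    by (rule negligible_hyperplane) simp
  then have "negligible neg"
    by (rule negligible_subset) (auto simp: neg_def inner_complex_def)
  moreover have "f differentiable_on neg"
    unfolding differentiable_on_def
  proof
    fix z assume "z \<in> neg"
    then have "z \<in> ball 0 1" using sub by (auto simp: neg_def)
    then show "f differentiable at z within neg"
      by (intro differentiableI[OF has_derivative_at_withinI[OF df]])
  qed
  \<comment> \<open>A differentiable map sends null sets to null sets, so removing the slit does not
    change the area of the image.\<close>
  ultimately have neg_null: "negligible (f ` neg)"
    by (intro negligible_differentiable_image_negligible) auto
  have "closed {z :: complex. Im z = 0 \<and> Re z \<le> 0}"
    by (intro closed_Collect_conj closed_halfspace_Re_le)
       (rule closed_Collect_eq; intro continuous_intros)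
  then have "open (ball 0 r - {z :: complex. Im z = 0 \<and> Re z \<le> 0})"
    using open_Diff[OF open_ball] by blast
  moreover have "ball 0 r - {z. Im z = 0 \<and> Re z \<le> 0} = ball 0 r - neg"
    by (auto simp: neg_def)
  ultimately have opn_dom: "open (ball 0 r - neg)" by (simp only:)
  \<comment> \<open>Openness provides the measurability needed to move the area to
    \<open>real^2\<close>.\<close>
  have opn: "open (f ` (ball 0 r - neg))"
    by (rule invariance_of_domain[OF _ opn_dom])
       (use contf inj sub in \<open>auto intro: continuous_on_subset inj_on_subset\<close>)
  define P where "P = (\<lambda>x::real^2. rcis (x $ 1) (x $ 2))"
  define a b :: "real^2" where "a = vector [0, - pi]" and "b = vector [r, pi]"
  have mem: "x \<in> box a b \<longleftrightarrow> 0 < x $ 1 \<and> x $ 1 < r \<and> - pi < x $ 2 \<and> x $ 2 < pi" for x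
    by (auto simp: mem_box_cart forall_2 a_def b_def)
  have memc: "x \<in> cbox a b \<longleftrightarrow> 0 \<le> x $ 1 \<and> x $ 1 \<le> r \<and> - pi \<le> x $ 2 \<and> x $ 2 \<le> pi" for x
    by (auto simp: mem_box_cart forall_2 a_def b_def)
  have P_ball: "P x \<in> ball 0 1" if "x \<in> cbox a b" for x
    using that r by (auto simp: memc P_def)
  have box_sub: "x \<in> cbox a b" if "x \<in> box a b" for x
    using that by (simp add: mem memc)
  have ArgP: "Arg (P x) = x $ 2" "norm (P x) = x $ 1" if "x \<in> box a b" for x
    using that Arg_rcis[of "x $ 2" "x $ 1"] by (simp_all add: mem P_def)
  have injP: "inj_on P (box a b)"
  proof (rule inj_onI)
    fix x y assume "x \<in> box a b" "y \<in> box a b" "P x = P y"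
    then show "x = y" using ArgP[of x] ArgP[of y] by (simp add: vec_eq_iff forall_2)
  qed
  have imgP: "P ` box a b = ball 0 r - neg"
  proof (intro equalityI subsetI)
    fix z assume "z \<in> P ` box a b"
    then obtain x where x: "x \<in> box a b" "z = P x" by (elim imageE)
    then have "Arg z \<noteq> pi" "z \<noteq> 0" "norm z < r" using ArgP[OF x(1)] by (auto simp: mem)
    then show "z \<in> ball 0 r - neg"
      by (auto simp: neg_def Arg_eq_pi complex_eq_iff)
  next
    fix z assume z: "z \<in> ball 0 r - neg"
    then have "z \<noteq> 0" "Arg z \<noteq> pi" by (auto simp: neg_def Arg_eq_pi)
    then have "vector [norm z, Arg z] \<in> box a b"
      using z Arg_le_pi[of z] mpi_less_Arg[of z] unfolding mem by auto
    moreover have "z = P (vector [norm z, Arg z])" by (simp add: P_def rcis_cmod_Arg)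
    ultimately show "z \<in> P ` box a b" by blast
  qed
  define F where "F = complex_vec2 \<circ> f \<circ> P"
  \<comment> \<open>Derivative of \<open>t * exp (\<i> * \<theta>)\<close>: the first summand is the
    radial direction, the second the angular one.\<close>
  define DP where "DP = (\<lambda>(x::real^2) (v::real^2). of_real (v $ 1) * exp (\<i> * of_real (x $ 2))
      + \<i> * of_real (x $ 1) * exp (\<i> * of_real (x $ 2)) * of_real (v $ 2))"
  define L where "L = (\<lambda>x v. A (P x) * DP x v + cnj (B (P x) * DP x v))"
  have dnth: "((\<lambda>x::real^2. x $ i) has_derivative (\<lambda>v. v $ i)) (at x)" for i x
    by (rule bounded_linear_imp_has_derivative[OF bounded_linear_vec_nth])
  have dexp: "((\<lambda>x::real^2. exp (\<i> * of_real (x $ 2))) has_derivative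
      (\<lambda>v. exp (\<i> * of_real (x $ 2)) * (\<i> * of_real (v $ 2)))) (at x)" for x
    by (rule has_derivative_compose[OF _ DERIV_exp[unfolded has_field_derivative_def]])
       (auto intro!: derivative_eq_intros dnth)
  have dP: "(P has_derivative DP x) (at x)" for x
    unfolding P_def rcis_eq DP_def
    by (rule has_derivative_eq_rhs[OF has_derivative_mult[OF has_derivative_of_real[OF dnth] dexp]])
       (simp add: fun_eq_iff algebra_simps)
  have dF: "(F has_derivative (\<lambda>v. complex_vec2 (L x v))) (at x)" if "x \<in> cbox a b" for x
    unfolding F_def L_def comp_assoc
    unfolding o_def[of complex_vec2]
    using diff_chain_at[OF dP df[OF P_ball[OF that]]]
    by (intro bounded_linear.has_derivative[OF bounded_linear_complex_vec2]) (simp add: o_def)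
  define J where "J = (\<lambda>x. x $ 1 * ((norm (A (P x)))\<^sup>2 - (norm (B (P x)))\<^sup>2))"
  have det: "det (matrix (\<lambda>v. complex_vec2 (L x v))) = J x" for x
  proof -
    let ?e = "exp (\<i> * of_real (x $ 2))"
    have 1: "L x (axis 1 1) = A (P x) * ?e + cnj (B (P x) * ?e)"
      by (simp add: L_def DP_def axis_def)
    have 2: "L x (axis 2 1) = \<i> * of_real (x $ 1) * (A (P x) * ?e) + cnj (\<i> * of_real (x $ 1) * (B (P x) * ?e))"
      by (simp add: L_def DP_def axis_def mult_ac)
    have "det (matrix (\<lambda>v. complex_vec2 (L x v))) =
        Re (L x (axis 1 1)) * Im (L x (axis 2 1)) - Re (L x (axis 2 1)) * Im (L x (axis 1 1))"
      by (simp add: det_2 matrix_def complex_vec2_def)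
    also have "\<dots> = x $ 1 * ((norm (A (P x) * ?e))\<^sup>2 - (norm (B (P x) * ?e))\<^sup>2)"
      unfolding 1 2 by (rule det_real_linear_complex)
    finally show ?thesis by (simp add: J_def norm_mult)
  qed
  have contP: "continuous_on S P" for S
    using dP by (meson continuous_at_imp_continuous_on has_derivative_continuous)
  have contJ: "continuous_on (cbox a b) J"
    unfolding J_def using P_ball
    by (intro continuous_intros continuous_on_compose2[OF contA contP] continuous_on_compose2[OF contB contP]) auto
  have Jnn: "J x \<ge> 0" if "x \<in> box a b" for x
    unfolding J_def using that le[OF P_ball[OF box_sub[OF that]]]
    by (intro mult_nonneg_nonneg) (auto simp: mem intro!: power_mono)
  have "measure lebesgue (f ` ball 0 r) = measure lebesgue (f ` (ball 0 r - neg) \<union> f ` neg)"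
    by (rule arg_cong[where f = "measure lebesgue"]) (auto simp: neg_def)
  also have "\<dots> = measure lebesgue (f ` (ball 0 r - neg))"
    using opn neg_null by (intro measure_Un_null_set) (auto simp: negligible_iff_null_sets)
  also have "\<dots> = measure lebesgue (complex_vec2 ` f ` (ball 0 r - neg))"
    by (rule measure_lebesgue_complex_vec2[OF opn, symmetric])
  also have "complex_vec2 ` f ` (ball 0 r - neg) = F ` box a b"
    unfolding F_def imgP[symmetric] by (simp add: image_comp comp_assoc)
  also have "measure lebesgue (F ` box a b) = integral (box a b) (\<lambda>x. \<bar>det (matrix (\<lambda>v. complex_vec2 (L x v)))\<bar>)"
  proof (rule measure_differentiable_image_eq)
    show "(F has_derivative (\<lambda>v. complex_vec2 (L x v))) (at x within box a b)" if "x \<in> box a b" for x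
      using dF[OF box_sub[OF that]] by (rule has_derivative_at_withinI)
    show "inj_on F (box a b)"
    proof -
      have "inj complex_vec2" by (metis injI complex_vec2_inverse)
      moreover have "inj_on f (P ` box a b)"
        unfolding imgP by (rule inj_on_subset[OF inj]) (use sub in auto)
      ultimately show ?thesis
        unfolding F_def using injP by (metis comp_inj_on inj_on_subset subset_UNIV)
    qed
    have "(\<lambda>x. \<bar>J x\<bar>) integrable_on cbox a b"
      by (intro integrable_continuous continuous_intros contJ)
    then show "(\<lambda>x. \<bar>det (matrix (\<lambda>v. complex_vec2 (L x v)))\<bar>) integrable_on box a b"
      unfolding det by (simp add: integrable_on_open_interval)
  qed simp
  also have "\<dots> = integral (box a b) J"
    unfolding det using Jnn by (intro integral_cong) auto
  \<comment> \<open>Injectivity requires the open box, iterated integration the closed one; their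
    integrals agree.\<close>
  also have "\<dots> = integral (cbox a b) J" by (rule integral_open_interval)
  also have "\<dots> = integral {a$1..b$1} (\<lambda>x. integral {a$2..b$2} (\<lambda>y. J (vector [x, y])))"
    by (rule integral_vec2_prod[OF contJ])
  finally show ?thesis by (simp add: J_def P_def a_def b_def)
qed

section \<open>The area estimate\<close>

text \<open>\<open>deriv K\<close> is real on the real diameter by its differential equation, so the
  real part of its square is the square itself, as a real number.\<close>

theorem theorem2p3:
  fixes \<phi> K f :: "complex \<Rightarrow> complex" and \<alpha> :: complex and r :: real
  assumes "ma_minda \<phi>"
    and "K holomorphic_on unit_disc" and "K 0 = 0" and "deriv K 0 = 1"
    and "\<forall>z\<in>unit_disc. 1 + z * deriv (deriv K) z / deriv K z = \<phi> z"
    and "cmod \<alpha> \<le> 1"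
    and "harmonic_convex_class \<phi> \<alpha> f"
    and "0 < r" and "r < 1"
  shows "2 * pi * integral {0..r}
           (\<lambda>t. t * (1 - (cmod \<alpha>)\<^sup>2 * t\<^sup>2) * Re ((deriv K (complex_of_real (- t)))\<^sup>2))
         \<le> measure lebesgue (f ` ball 0 r)
       \<and> measure lebesgue (f ` ball 0 r)
         \<le> 2 * pi * integral {0..r}
           (\<lambda>t. t * (1 - (cmod \<alpha>)\<^sup>2 * t\<^sup>2) * Re ((deriv K (complex_of_real t))\<^sup>2))"
proof -
  obtain h g where hc: "convex_class \<phi> h" and holg: "g holomorphic_on ball 0 1"
    and dg: "\<And>z. z \<in> ball 0 1 \<Longrightarrow> deriv g z = \<alpha> * z * deriv h z"
    and f_eq: "\<And>z. z \<in> ball 0 1 \<Longrightarrow> f z = h z + cnj (g z)"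
    using assms(7) unfolding harmonic_convex_class_def by blast
  have holh: "h holomorphic_on ball 0 1" and injh: "inj_on h (ball 0 1)" and dh0: "deriv h 0 = 1"
    and subh: "subordinate (\<lambda>z. 1 + z * deriv (deriv h) z / deriv h z) \<phi>"
    using hc by (auto simp: convex_class_def)
  have holdh: "deriv h holomorphic_on ball 0 1" and holdg: "deriv g holomorphic_on ball 0 1"
    and holdK: "deriv K holomorphic_on ball 0 1"
    using holh holg assms(2) by (auto intro: holomorphic_deriv)
  have dh_nz: "deriv h z \<noteq> 0" if "z \<in> ball 0 1" for z
    by (rule holomorphic_injective_imp_regular[OF holh open_ball injh that])
  have pos: "Re (1 + z * deriv (deriv h) z / deriv h z) > 0" if "z \<in> ball 0 1" for z
  proof -
    obtain \<omega> where "\<omega> ` ball 0 1 \<subseteq> ball 0 1" "1 + z * deriv (deriv h) z / deriv h z = \<phi> (\<omega> z)"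
      using subh \<open>z \<in> ball 0 1\<close> unfolding subordinate_def by blast
    then show ?thesis using assms(1) that by (auto simp: ma_minda_def image_subset_iff)
  qed
  have norm_dg: "norm (deriv g z) = norm \<alpha> * norm z * norm (deriv h z)" if "z \<in> ball 0 1" for z
    using dg[OF that] by (simp add: norm_mult)
  have dg_le: "norm (deriv g z) \<le> norm z * norm (deriv h z)" if "z \<in> ball 0 1" for z
    unfolding norm_dg[OF that] using assms(6) by (intro mult_right_mono mult_left_le_one_le) auto
  have injf: "inj_on (\<lambda>z. h z + cnj (g z)) (ball 0 1)"
    by (rule harmonic_convex_inj[OF holh injh pos holg dg_le])
  have rcis_ball: "rcis t \<theta> \<in> ball 0 1" if "t \<in> {0..r}" for t \<theta>
    using that assms(9) by simp
  define G where "G = (\<lambda>t \<theta>. t * (1 - (norm \<alpha>)\<^sup>2 * t\<^sup>2) * (norm (deriv h (rcis t \<theta>)))\<^sup>2)"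
  have "measure lebesgue (f ` ball 0 r) = measure lebesgue ((\<lambda>z. h z + cnj (g z)) ` ball 0 r)"
    using f_eq assms(9) by (intro arg_cong[where f = "measure lebesgue"] image_cong) auto
  also have "\<dots> = integral {0..r} (\<lambda>t. integral {-pi..pi}
      (\<lambda>\<theta>. t * ((norm (deriv h (rcis t \<theta>)))\<^sup>2 - (norm (deriv g (rcis t \<theta>)))\<^sup>2)))"
  proof (rule measure_image_ball_polar[OF _ _ _ injf _ assms(8,9)])
    fix z :: complex assume z: "z \<in> ball 0 1"
    have "(h has_derivative (*) (deriv h z)) (at z)" "(g has_derivative (*) (deriv g z)) (at z)"
      using holomorphic_derivI[OF holh open_ball z] holomorphic_derivI[OF holg open_ball z]
      by (simp_all add: has_field_derivative_def)
    then show "((\<lambda>z. h z + cnj (g z)) has_derivative (\<lambda>v. deriv h z * v + cnj (deriv g z * v))) (at z)"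
      by (intro has_derivative_add has_derivative_cnj)
    show "norm (deriv g z) \<le> norm (deriv h z)"
      using dg_le[OF z] z by (smt (verit) dist_0_norm mem_ball mult_left_le_one_le norm_ge_zero)
  qed (intro holomorphic_on_imp_continuous_on holdh holdg)+
  also have "\<dots> = integral {0..r} (\<lambda>t. integral {-pi..pi} (G t))"
  proof (intro integral_cong)
    fix t \<theta> assume "t \<in> {0..r}"
    then show "t * ((norm (deriv h (rcis t \<theta>)))\<^sup>2 - (norm (deriv g (rcis t \<theta>)))\<^sup>2) = G t \<theta>"
      using norm_dg[OF rcis_ball[of t \<theta>]]
      by (simp add: G_def power_mult_distrib algebra_simps)
  qed
  finally have area: "measure lebesgue (f ` ball 0 r) = integral {0..r} (\<lambda>t. integral {-pi..pi} (G t))" .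
  have contG: "continuous_on ({0..r} \<times> {-pi..pi}) (\<lambda>(t, \<theta>). G t \<theta>)"
    unfolding G_def case_prod_beta rcis_def
    using rcis_ball
    by (intro continuous_intros continuous_on_compose2[OF holomorphic_on_imp_continuous_on[OF holdh]])
       (auto simp: rcis_def)
  have int_outer: "(\<lambda>t. integral {-pi..pi} (G t)) integrable_on {0..r}"
    using integral_continuous_on_param[of "{0..r}" "-pi" pi G] contG
    by (intro integrable_continuous_real) simp
  have int_inner: "G t integrable_on {-pi..pi}" if "t \<in> {0..r}" for t
  proof (rule integrable_continuous_real)
    have "continuous_on {-pi..pi} (\<lambda>\<theta>. (\<lambda>(t, \<theta>). G t \<theta>) (t, \<theta>))"
      using that by (intro continuous_on_compose2[OF contG] continuous_on_Pair continuous_on_const continuous_on_id) auto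
    then show "continuous_on {-pi..pi} (G t)" by simp
  qed
  \<comment> \<open>The sign \<open>s\<close> covers the integrands of both bounds, with
    \<open>s = -1\<close> for the lower and \<open>s = 1\<close> for the upper one.\<close>
  have contK: "continuous_on {0..r} (\<lambda>t. t * (1 - (norm \<alpha>)\<^sup>2 * t\<^sup>2) * Re ((deriv K (of_real (s * t)))\<^sup>2))"
    if "\<bar>s\<bar> = 1" for s
    using that assms(9)
    by (intro continuous_intros continuous_on_compose2[OF holomorphic_on_imp_continuous_on[OF holdK]])
       (auto simp: norm_mult)
  have growth: "Re ((deriv K (of_real (- t)))\<^sup>2) \<le> (norm (deriv h (rcis t \<theta>)))\<^sup>2"
      "(norm (deriv h (rcis t \<theta>)))\<^sup>2 \<le> Re ((deriv K (of_real t))\<^sup>2)" if t: "t \<in> {0..r}" for t \<theta>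
    using ma_minda_growth[OF assms(1) holdh dh0 dh_nz subh holdK assms(4) _ rcis_ball[OF t, of \<theta>]]
      assms(5) t by auto
  \<comment> \<open>Nonnegativity of the weight lets the growth bounds be multiplied by it; it
    follows from \<open>norm \<alpha> * t \<le> 1\<close>.\<close>
  have weight: "t * (1 - (norm \<alpha>)\<^sup>2 * t\<^sup>2) \<ge> 0" if "t \<in> {0..r}" for t
  proof -
    have "norm \<alpha> * t \<le> 1" using that assms(6,9) by (intro mult_le_one) auto
    then have "(norm \<alpha> * t)\<^sup>2 \<le> 1" using that by (intro power_le_one) auto
    then show ?thesis using that by (simp add: power_mult_distrib)
  qed
  \<comment> \<open>The bounds do not depend on the angle; rewriting them as integrals over the
    circle reduces the claim to a pointwise comparison with \<open>G\<close> and accounts for the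
    factor \<open>2 * pi\<close>.\<close>
  have const: "integral {-pi..pi} (\<lambda>\<theta>. c) = 2 * pi * c" for c :: real
    by simp
  show ?thesis
  proof
    have "integral {0..r} (\<lambda>t. 2 * pi * (t * (1 - (norm \<alpha>)\<^sup>2 * t\<^sup>2) * Re ((deriv K (of_real (- t)))\<^sup>2)))
        \<le> integral {0..r} (\<lambda>t. integral {-pi..pi} (G t))"
    proof (rule integral_le[OF _ int_outer])
      show "(\<lambda>t. 2 * pi * (t * (1 - (norm \<alpha>)\<^sup>2 * t\<^sup>2) * Re ((deriv K (of_real (- t)))\<^sup>2))) integrable_on {0..r}"
        using contK[of "-1"] by (intro integrable_continuous_real continuous_on_mult_left) simp
      fix t assume t: "t \<in> {0..r}"
      show "2 * pi * (t * (1 - (norm \<alpha>)\<^sup>2 * t\<^sup>2) * Re ((deriv K (of_real (- t)))\<^sup>2)) \<le> integral {-pi..pi} (G t)"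
        unfolding const[symmetric]
        by (rule integral_le[OF _ int_inner[OF t]])
           (auto simp only: G_def intro!: mult_left_mono growth weight t)
    qed
    then show "2 * pi * integral {0..r}
           (\<lambda>t. t * (1 - (cmod \<alpha>)\<^sup>2 * t\<^sup>2) * Re ((deriv K (complex_of_real (- t)))\<^sup>2))
         \<le> measure lebesgue (f ` ball 0 r)"
      unfolding area by (simp only: integral_mult_right)
    have "integral {0..r} (\<lambda>t. integral {-pi..pi} (G t)) \<le>
        integral {0..r} (\<lambda>t. 2 * pi * (t * (1 - (norm \<alpha>)\<^sup>2 * t\<^sup>2) * Re ((deriv K (of_real t))\<^sup>2)))"
    proof (rule integral_le[OF int_outer])
      show "(\<lambda>t. 2 * pi * (t * (1 - (norm \<alpha>)\<^sup>2 * t\<^sup>2) * Re ((deriv K (of_real t))\<^sup>2))) integrable_on {0..r}"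
        using contK[of 1] by (intro integrable_continuous_real continuous_on_mult_left) simp
      fix t assume t: "t \<in> {0..r}"
      show "integral {-pi..pi} (G t) \<le> 2 * pi * (t * (1 - (norm \<alpha>)\<^sup>2 * t\<^sup>2) * Re ((deriv K (of_real t))\<^sup>2))"
        unfolding const[symmetric]
        by (rule integral_le[OF int_inner[OF t]])
           (auto simp only: G_def intro!: mult_left_mono growth weight t)
    qed
    then show "measure lebesgue (f ` ball 0 r)
         \<le> 2 * pi * integral {0..r}
           (\<lambda>t. t * (1 - (cmod \<alpha>)\<^sup>2 * t\<^sup>2) * Re ((deriv K (complex_of_real t))\<^sup>2))"
      unfolding area by (simp only: integral_mult_right)
  qed
qed

end
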